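(* Let $f:\mathbb{R}^n\to\mathbb{R}^n$ be a function, $F:\mathbb{R}^n\rightrightarrows\mathbb{R}^n$ a set-valued map with closed graph, and $p:[0,1]\to\mathbb{R}^n$ a function. For $t\in[0,1]$ put $G_t(v)=f(v)-p(t)+F(v)$ and $S(t)=\{z\in\mathbb{R}^n : 0\in G_t(z)\}$. Assume that (i) $z:[0,1]\to\mathbb{R}^n$ is a given continuous solution trajectory (that is, $z$ is continuous and $z(t)\in S(t)$ for all $t\in[0,1]$); (ii) $p$ is a continuous function; (iii) for every $t\in[0,1]$, $G_t$ is strongly metrically regular at $z(t)$ for $0$. Then there exist constants $a,b,\kappa>0$ such that for every $t\in[0,1]$ the mapping $$\mathbb{B}_b(0)\ni y\longmapsto G_t^{-1}(y)\cap\mathbb{B}_a(z(t))$$ is single-valued and Lipschitz continuous with Lipschitz constant $\kappa$.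
   Context: $\mathbb{B}_r(x)$ denotes the closed Euclidean ball of radius $r$ around $x$. "Single-valued" means having exactly one element for each $y$ in the indicated domain. $G_t$ is strongly metrically regular at $z(t)$ for $0$ if $0\in G_t(z(t))$ and there exist constants $a_t,b_t,\kappa_t>0$ (possibly depending on $t$) such that the mapping $\mathbb{B}_{b_t}(0)\ni y\mapsto G_t^{-1}(y)\cap\mathbb{B}_{a_t}(z(t))$ is single-valued and Lipschitz continuous with Lipschitz constant $\kappa_t$. *)

theory Defs
  imports "HOL-Analysis.Analysis"
begin

text \<open>
  A set-valued map from \<open>'a\<close> to \<open>'b\<close> is a function \<open>'a \<Rightarrow> 'b set\<close>; its values may be empty.
\<close>

definition sv_graph :: "('a \<Rightarrow> 'b set) \<Rightarrow> ('a \<times> 'b) set" where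
  "sv_graph M = {(v, y). y \<in> M v}"

definition sv_inverse :: "('a \<Rightarrow> 'b set) \<Rightarrow> 'b \<Rightarrow> 'a set" where
  "sv_inverse M y = {v. y \<in> M v}"

definition single_valued_on :: "'a set \<Rightarrow> ('a \<Rightarrow> 'b set) \<Rightarrow> bool" where
  "single_valued_on U M \<longleftrightarrow> (\<forall>y\<in>U. \<exists>!v. v \<in> M y)"

text \<open>
  Lipschitz continuity refers to the function that selects the only element of each value.
\<close>

definition single_valued_lipschitz_on ::
  "real \<Rightarrow> 'a::metric_space set \<Rightarrow> ('a \<Rightarrow> 'b::metric_space set) \<Rightarrow> bool" where
  "single_valued_lipschitz_on \<kappa> U M \<longleftrightarrow>
     single_valued_on U M \<and> \<kappa>-lipschitz_on U (\<lambda>y. THE v. v \<in> M y)"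

definition strongly_metrically_regular ::
  "('a::metric_space \<Rightarrow> 'b::metric_space set) \<Rightarrow> 'a \<Rightarrow> 'b \<Rightarrow> bool" where
  "strongly_metrically_regular M x y0 \<longleftrightarrow>
     y0 \<in> M x \<and>
     (\<exists>a>0. \<exists>b>0. \<exists>\<kappa>>0.
        single_valued_lipschitz_on \<kappa> (cball y0 b) (\<lambda>y. sv_inverse M y \<inter> cball x a))"

definition gen_eq_map ::
  "('a \<Rightarrow> 'b::ab_group_add) \<Rightarrow> (real \<Rightarrow> 'b) \<Rightarrow> ('a \<Rightarrow> 'b set) \<Rightarrow> real \<Rightarrow> 'a \<Rightarrow> 'b set" where
  "gen_eq_map f p F t v = {f v - p t + w | w. w \<in> F v}"

definition solution_set ::
  "('a \<Rightarrow> 'b::ab_group_add) \<Rightarrow> (real \<Rightarrow> 'b) \<Rightarrow> ('a \<Rightarrow> 'b set) \<Rightarrow> real \<Rightarrow> 'a set" where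
  "solution_set f p F t = {z. 0 \<in> gen_eq_map f p F t z}"

end

theory Submission
  imports Defs
begin

text \<open>
  Put \<open>H = f + F\<close>. Then \<open>G\<^sub>t\<inverse>(y) = H\<inverse>(y + p(t))\<close>, so all the hypotheses speak about the single map
  \<open>H\<inverse>\<close>. If its localization around \<open>(p(t), z(t))\<close> has a Lipschitz selection \<open>g\<close>, then for \<open>s\<close> near
  \<open>t\<close> uniqueness forces \<open>z(s) = g(p(s))\<close>, and the Lipschitz bound keeps \<open>g(y)\<close> within \<open>\<kappa>\<^sub>t b\<close> of \<open>z(s)\<close>
  for \<open>y \<in> \<B>\<^sub>b(p(s))\<close>. So any radii \<open>a\<close>, \<open>b\<close> that are small compared with those at \<open>t\<close> and satisfy
  \<open>\<kappa>\<^sub>t b \<le> a\<close> serve for all such \<open>s\<close>, and compactness of \<open>[0,1]\<close> leaves finitely many \<open>t\<close> to consider.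
\<close>

text \<open>Trades the definite description for an arbitrary witness \<open>g\<close>, so that later
  proofs can restrict or shift one selection and reuse its Lipschitz bound.\<close>

lemma single_valued_lipschitz_on_iff:
  "single_valued_lipschitz_on \<kappa> U M \<longleftrightarrow> (\<exists>g. (\<forall>y\<in>U. M y = {g y}) \<and> \<kappa>-lipschitz_on U g)"
proof
  assume svl: "single_valued_lipschitz_on \<kappa> U M"
  have "M y = {THE v. v \<in> M y}" if "y \<in> U" for y
  proof -
    have "\<exists>!v. v \<in> M y"
      using svl that by (simp add: single_valued_lipschitz_on_def single_valued_on_def)
    then have "v \<in> M y \<longleftrightarrow> v = (THE v. v \<in> M y)" for v
      by (metis theI')
    then show ?thesis by blast
  qed
  then show "\<exists>g. (\<forall>y\<in>U. M y = {g y}) \<and> \<kappa>-lipschitz_on U g"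
    using svl unfolding single_valued_lipschitz_on_def
    by (intro exI[of _ "\<lambda>y. THE v. v \<in> M y"]) simp
next
  assume "\<exists>g. (\<forall>y\<in>U. M y = {g y}) \<and> \<kappa>-lipschitz_on U g"
  then obtain g where g: "\<And>y. y \<in> U \<Longrightarrow> M y = {g y}" and lip: "\<kappa>-lipschitz_on U g"
    by blast
  have "\<kappa>-lipschitz_on U (\<lambda>y. THE v. v \<in> M y)"
    by (rule lipschitz_on_transform[OF lip]) (simp add: g)
  then show "single_valued_lipschitz_on \<kappa> U M"
    unfolding single_valued_lipschitz_on_def single_valued_on_def by (simp add: g)
qed

text \<open>Translations are isometries, so balls go to balls of the same radius and the constant
  survives. This carries statements between balls around 0 and balls around
  \<open>p t\<close>.\<close>

lemma single_valued_lipschitz_on_translation: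
  fixes M :: "'a::real_normed_vector \<Rightarrow> 'b::metric_space set"
  assumes "single_valued_lipschitz_on \<kappa> (cball c b) M"
  shows "single_valued_lipschitz_on \<kappa> (cball (c - d) b) (\<lambda>y. M (y + d))"
proof -
  obtain g where g: "\<And>y. y \<in> cball c b \<Longrightarrow> M y = {g y}" and lip: "\<kappa>-lipschitz_on (cball c b) g"
    using assms unfolding single_valued_lipschitz_on_iff by blast
  have shift: "y + d \<in> cball c b" if "y \<in> cball (c - d) b" for y
    using that by (simp add: dist_norm algebra_simps)
  have "\<kappa>-lipschitz_on (cball (c - d) b) (\<lambda>y. g (y + d))"
  proof (rule lipschitz_onI)
    show "0 \<le> \<kappa>" by (rule lipschitz_on_nonneg[OF lip])
    fix x y assume "x \<in> cball (c - d) b" "y \<in> cball (c - d) b"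
    then show "dist (g (x + d)) (g (y + d)) \<le> \<kappa> * dist x y"
      using lipschitz_onD[OF lip shift shift] by simp
  qed
  then show ?thesis
    unfolding single_valued_lipschitz_on_iff
    using g[OF shift] by (intro exI[of _ "\<lambda>y. g (y + d)"]) simp
qed

lemma cball_subset_cball_dist:
  assumes "dist u v + r \<le> R"
  shows "cball v r \<subseteq> cball u R"
proof
  fix w assume "w \<in> cball v r"
  then show "w \<in> cball u R"
    using assms dist_triangle[of u w v] by simp
qed

text \<open>Shrinking the ball of values cannot spoil uniqueness, only existence. Existence is saved
  by \<open>k * b \<le> a\<close>: the selection passes through \<open>x\<close> at
  \<open>q\<close>, so over \<open>cball q b\<close> it stays within \<open>a\<close> of
  \<open>x\<close>.\<close>

lemma single_valued_lipschitz_on_recenter: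
  assumes svl: "single_valued_lipschitz_on k (cball q\<^sub>0 \<beta>) (\<lambda>y. N y \<inter> cball x\<^sub>0 \<alpha>)"
    and x: "x \<in> N q"
    and \<alpha>: "dist x\<^sub>0 x + a \<le> \<alpha>" and \<beta>: "dist q\<^sub>0 q + b \<le> \<beta>"
    and pos: "0 \<le> a" "0 \<le> b" and kb: "k * b \<le> a" and "k \<le> \<kappa>"
  shows "single_valued_lipschitz_on \<kappa> (cball q b) (\<lambda>y. N y \<inter> cball x a)"
proof -
  obtain g where g: "\<And>y. y \<in> cball q\<^sub>0 \<beta> \<Longrightarrow> N y \<inter> cball x\<^sub>0 \<alpha> = {g y}"
    and lip: "k-lipschitz_on (cball q\<^sub>0 \<beta>) g"
    using svl unfolding single_valued_lipschitz_on_iff by blast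
  have Y: "cball q b \<subseteq> cball q\<^sub>0 \<beta>" and X: "cball x a \<subseteq> cball x\<^sub>0 \<alpha>"
    using \<alpha> \<beta> by (simp_all add: cball_subset_cball_dist)
  have q: "q \<in> cball q\<^sub>0 \<beta>" and x': "x \<in> cball x\<^sub>0 \<alpha>"
    using \<alpha> \<beta> pos by simp_all
  \<comment> \<open>Both \<open>x\<close> and \<open>g q\<close> lie in the singleton
    \<open>N q \<inter> cball x\<^sub>0 \<alpha>\<close>.\<close>
  have gq: "g q = x"
    using g[OF q] IntI[OF x x'] by simp
  have "N y \<inter> cball x a = {g y}" if y: "y \<in> cball q b" for y
  proof -
    have "dist x (g y) \<le> k * dist q y"
      using lipschitz_onD[OF lip q subsetD[OF Y y]] gq by simp
    also have "\<dots> \<le> k * b"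
      using y lipschitz_on_nonneg[OF lip] by (simp add: mult_left_mono)
    finally have "g y \<in> cball x a"
      using kb by simp
    then show ?thesis
      using g[OF subsetD[OF Y y]] X by blast
  qed
  moreover have "\<kappa>-lipschitz_on (cball q b) g"
    using lip Y \<open>k \<le> \<kappa>\<close> by (rule lipschitz_on_mono)
  ultimately show ?thesis
    unfolding single_valued_lipschitz_on_iff by blast
qed

lemma sv_inverse_gen_eq_map:
  "sv_inverse (gen_eq_map f p F t) y = sv_inverse (\<lambda>v. {f v + w | w. w \<in> F v}) (y + p t)"
  by (simp add: sv_inverse_def gen_eq_map_def diff_add_eq eq_diff_eq)

text \<open>Since \<open>N\<close> does not depend on \<open>t\<close>, regularity at
  \<open>t\<close> can be recentered at every nearby point of the trajectory. A finite subcover then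
  leaves finitely many radii and constants to compare.\<close>

lemma single_valued_lipschitz_on_uniform:
  fixes N :: "'b::metric_space \<Rightarrow> 'a::metric_space set"
    and z :: "'t::metric_space \<Rightarrow> 'a" and p :: "'t \<Rightarrow> 'b"
  assumes T: "compact T" and z: "continuous_on T z" and p: "continuous_on T p"
    and sol: "\<And>t. t \<in> T \<Longrightarrow> z t \<in> N (p t)"
    and reg: "\<And>t. t \<in> T \<Longrightarrow> \<exists>a>0. \<exists>b>0. \<exists>\<kappa>>0.
      single_valued_lipschitz_on \<kappa> (cball (p t) b) (\<lambda>y. N y \<inter> cball (z t) a)"
  shows "\<exists>a>0. \<exists>b>0. \<exists>\<kappa>>0. \<forall>t\<in>T.
    single_valued_lipschitz_on \<kappa> (cball (p t) b) (\<lambda>y. N y \<inter> cball (z t) a)"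
proof -
  obtain \<alpha> \<beta> k where pos: "\<And>t. t \<in> T \<Longrightarrow> 0 < \<alpha> t \<and> 0 < \<beta> t \<and> 0 < k t"
    and svl: "\<And>t. t \<in> T \<Longrightarrow>
      single_valued_lipschitz_on (k t) (cball (p t) (\<beta> t)) (\<lambda>y. N y \<inter> cball (z t) (\<alpha> t))"
    using reg by metis
  \<comment> \<open>Half of each radius pays for moving the centers from \<open>t\<close> to
    \<open>s\<close>; the other half is left for the new balls.\<close>
  have "\<exists>r>0. \<forall>s\<in>T. dist s t < r \<longrightarrow>
      dist (z t) (z s) < \<alpha> t / 2 \<and> dist (p t) (p s) < \<beta> t / 2" if t: "t \<in> T" for t
  proof -
    obtain r where "r > 0" "\<forall>s\<in>T. dist s t < r \<longrightarrow> dist (z s) (z t) < \<alpha> t / 2"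
      using z t half_gt_zero[of "\<alpha> t"] pos[OF t] unfolding continuous_on_iff by blast
    moreover obtain r' where "r' > 0" "\<forall>s\<in>T. dist s t < r' \<longrightarrow> dist (p s) (p t) < \<beta> t / 2"
      using p t half_gt_zero[of "\<beta> t"] pos[OF t] unfolding continuous_on_iff by blast
    ultimately show ?thesis
      by (intro exI[of _ "min r r'"]) (simp add: dist_commute)
  qed
  then obtain r where r: "\<And>t. t \<in> T \<Longrightarrow> 0 < r t"
    and near: "\<And>s t. \<lbrakk>t \<in> T; s \<in> T; dist s t < r t\<rbrakk> \<Longrightarrow>
      dist (z t) (z s) < \<alpha> t / 2 \<and> dist (p t) (p s) < \<beta> t / 2"
    by metis
  have "T \<subseteq> (\<Union>t\<in>T. ball t (r t))"
    using r by auto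
  then obtain C where C: "C \<subseteq> T" "finite C" and cover: "T \<subseteq> (\<Union>t\<in>C. ball t (r t))"
    using compactE_image[OF T, of T "\<lambda>t. ball t (r t)"] by auto
  \<comment> \<open>The inserted 1 keeps the sets nonempty even if \<open>C\<close> is empty, and in
    the maximum it makes \<kappa> positive. The entry \<open>a / \<kappa>\<close> in
    \<open>b\<close> yields \<open>\<kappa> * b \<le> a\<close>, hence
    \<open>k t * b \<le> a\<close> for all \<open>t\<close> in \<open>C\<close>.\<close>
  define a where "a = Min (insert 1 ((\<lambda>t. \<alpha> t / 2) ` C))"
  define \<kappa> where "\<kappa> = Max (insert 1 (k ` C))"
  define b where "b = Min (insert (a / \<kappa>) ((\<lambda>t. \<beta> t / 2) ` C))"
  have "a > 0"
    using C pos by (auto simp: a_def)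
  have a: "a \<le> \<alpha> t / 2" if "t \<in> C" for t
    unfolding a_def using C that by (intro Min_le) auto
  have "\<kappa> \<ge> 1"
    using C by (simp add: \<kappa>_def)
  have \<kappa>: "k t \<le> \<kappa>" if "t \<in> C" for t
    unfolding \<kappa>_def using C that by (intro Max_ge) auto
  have "b > 0"
    using C pos \<open>a > 0\<close> \<open>\<kappa> \<ge> 1\<close> by (auto simp: b_def)
  have "b \<le> a / \<kappa>"
    unfolding b_def using C by (intro Min_le) auto
  have b: "b \<le> \<beta> t / 2" if "t \<in> C" for t
    unfolding b_def using C that by (intro Min_le) auto
  have "single_valued_lipschitz_on \<kappa> (cball (p s) b) (\<lambda>y. N y \<inter> cball (z s) a)"
    if s: "s \<in> T" for s
  proof -
    obtain t where t: "t \<in> C" "dist s t < r t"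
      using cover s by (auto simp: dist_commute)
    then have "t \<in> T" using C by blast
    have "k t * b \<le> \<kappa> * b"
      using \<kappa>[OF t(1)] \<open>b > 0\<close> by simp
    also have "\<dots> \<le> a"
      using \<open>b \<le> a / \<kappa>\<close> \<open>\<kappa> \<ge> 1\<close> by (simp add: field_simps)
    finally have kb: "k t * b \<le> a" .
    have "dist (z t) (z s) + a \<le> \<alpha> t" "dist (p t) (p s) + b \<le> \<beta> t"
      using near[OF \<open>t \<in> T\<close> s t(2)] a[OF t(1)] b[OF t(1)] by linarith+
    then show ?thesis
      using \<open>a > 0\<close> \<open>b > 0\<close>
      by (intro single_valued_lipschitz_on_recenter[OF svl[OF \<open>t \<in> T\<close>] sol[OF s] _ _ _ _ kb \<kappa>[OF t(1)]])
        simp_all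
  qed
  moreover have "\<kappa> > 0"
    using \<open>\<kappa> \<ge> 1\<close> by simp
  ultimately show ?thesis
    using \<open>a > 0\<close> \<open>b > 0\<close> by blast
qed

theorem theorem4p8:
  fixes f :: "real ^ 'n \<Rightarrow> real ^ 'n"
    and F :: "real ^ 'n \<Rightarrow> (real ^ 'n) set"
    and p z :: "real \<Rightarrow> real ^ 'n"
  assumes "closed (sv_graph F)"
    and "continuous_on {0..1} z"
    and "\<forall>t\<in>{0..1}. z t \<in> solution_set f p F t"
    and "continuous_on {0..1} p"
    and "\<forall>t\<in>{0..1}. strongly_metrically_regular (gen_eq_map f p F t) (z t) 0"
  shows "\<exists>a>0. \<exists>b>0. \<exists>\<kappa>>0. \<forall>t\<in>{0..1}.
           single_valued_lipschitz_on \<kappa> (cball 0 b)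
             (\<lambda>y. sv_inverse (gen_eq_map f p F t) y \<inter> cball (z t) a)"
proof -
  define N where "N = sv_inverse (\<lambda>v. {f v + w | w. w \<in> F v})"
  have svl_iff: "single_valued_lipschitz_on \<kappa> (cball 0 b)
        (\<lambda>y. sv_inverse (gen_eq_map f p F t) y \<inter> cball (z t) a) \<longleftrightarrow>
      single_valued_lipschitz_on \<kappa> (cball (p t) b) (\<lambda>y. N y \<inter> cball (z t) a)" for \<kappa> a b t
    \<comment> \<open>The shift by \<open>- p t\<close> moves the center from 0 to
      \<open>p t\<close> and cancels the \<open>+ p t\<close> in the argument of \<open>N\<close>;
      the shift by \<open>p t\<close> undoes this.\<close>
    unfolding sv_inverse_gen_eq_map N_def[symmetric]
    using single_valued_lipschitz_on_translation[of \<kappa> 0 b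
        "\<lambda>y. N (y + p t) \<inter> cball (z t) a" "- p t"]
      single_valued_lipschitz_on_translation[of \<kappa> "p t" b
        "\<lambda>y. N y \<inter> cball (z t) a" "p t"]
    by auto
  have sol: "z t \<in> N (p t)" if "t \<in> {0..1}" for t
  proof -
    have "z t \<in> sv_inverse (gen_eq_map f p F t) 0"
      using assms(3) that by (simp add: solution_set_def sv_inverse_def)
    then show ?thesis
      unfolding sv_inverse_gen_eq_map N_def[symmetric] by simp
  qed
  show ?thesis
    using assms(5) unfolding strongly_metrically_regular_def svl_iff
    by (intro single_valued_lipschitz_on_uniform[OF compact_Icc assms(2,4) sol]) auto
qed

end
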